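(* Let $\mathcal{G}=(B\cup I,E)$ be a bipartite graph and let $\mathcal{M}$ be the transversal matroid on ground set $B$ (a set $T\subseteq B$ is independent iff the vertices of $T$ can be matched in $\mathcal{G}$ to distinct items of $I$). Each buyer $b\in B$ has a distribution $D_b$ over nonnegative reals, independent across buyers; a reward $r_b\sim D_b$ and a single sample $s_b\sim D_b$ are drawn, all independently, and every edge incident to $b$ inherits $b$'s weight. Consider the following algorithm. Fix an arbitrary ordering of $I$. Compute a greedy matching $M_S$ on $\mathcal{G}$ where each edge $\{b,i\}$ has weight $s_b$ (edges processed in non-increasing order of weight, ties among the edges of the same buyer broken according to the ordering on $I$, adding an edge whenever the result is still a matching). For each $\{b,i\}\in M_S$ set $p_b=p_i=s_b$; for each vertex $k$ unmatched in $M_S$ set $p_k=0$. Start with $M=\emptyset$. Buyers arrive in an arbitrary (adversarial) order; when $b$ arrives and $r_b$ is revealed, let $i^*$ be the first item in the ordering of $I$ with $\{b,i^*\}\in E$ and $r_b\ge\max\{p_b,p_{i^*}\}$ (if any); if such $i^*$ exists and is not yet matched in $M$, add $\{b,i^*\}$ to $M$ with weight $r_b$. Then, for any arrival order, $8\cdot\mathbb{E}[w(M)]\ge\mathbb{E}[\mathsf{OPT}]$, where $w(M)$ is the total reward of the buyers matched in $M$ and $\mathsf{OPT}$ is the maximum total reward $\sum_{b\in T}r_b$ of an independent set $T$ of $\mathcal{M}$.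
   Context: Single-sample prophet inequality for transversal matroids: the algorithm knows only one independent sample per buyer distribution; buyers arrive online in adversarial order and decisions are irrevocable.
   Formalization: With point masses the claim as written fails (all values 1, complete graph on 9 buyers and 9 items); so each reward and sample carries an independent tie-breaking label compared lexicographically, and for each buyer D_b or its label distribution has no point masses. *)

theory Defs
  imports "HOL-Probability.Probability"
begin

text \<open>
  The bipartite graph has buyers \<open>B :: 'b set\<close> on one side and, on the other, the items in the
  list \<open>items :: 'i list\<close>, which also carries the fixed ordering of the items; an edge is a pair
  \<open>(b, i)\<close>.

  Read with real numbers only, the algorithm does not say how two draws that happen to be equal
  compare, and if every such comparison \<open>r \<ge> p\<close> counts as true the approximation guarantee fails
  for distributions with point masses: if every reward and every sample is 1 and the graph is
  complete bipartite with \<open>n\<close> buyers and \<open>n\<close> items, then all prices are 1, every buyer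
  asks for the first item, and \<open>w(M) = 1\<close> while \<open>OPT = n\<close>.  Hence a draw is a pair of a value
  and a tie-breaking label, and draws are compared lexicographically.  If the distributions of
  the values have no point masses, the labels may be taken constantly 0, and then the
  comparison is the comparison of the values.
\<close>

type_synonym draw = "real \<times> real"

abbreviation val :: "draw \<Rightarrow> real" where
  "val \<equiv> fst"

definition draw_le :: "draw \<Rightarrow> draw \<Rightarrow> bool" where
  "draw_le x y \<longleftrightarrow> fst x < fst y \<or> fst x = fst y \<and> snd x \<le> snd y"

subsection \<open>The transversal matroid and the offline optimum\<close>

definition transversal_indep :: "'b set \<Rightarrow> ('b \<times> 'i) set \<Rightarrow> 'b set \<Rightarrow> bool" where
  "transversal_indep B E T \<longleftrightarrow>
     T \<subseteq> B \<and> (\<exists>m. inj_on m T \<and> (\<forall>b\<in>T. (b, m b) \<in> E))"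

definition offline_opt :: "'b set \<Rightarrow> ('b \<times> 'i) set \<Rightarrow> ('b \<Rightarrow> draw) \<Rightarrow> real" where
  "offline_opt B E r = Max ((\<lambda>T. \<Sum>b\<in>T. val (r b)) ` {T. transversal_indep B E T})"

subsection \<open>The greedy matching on the samples\<close>

definition matching :: "('b \<times> 'i) set \<Rightarrow> bool" where
  "matching M \<longleftrightarrow> (\<forall>e\<in>M. \<forall>f\<in>M. e \<noteq> f \<longrightarrow> fst e \<noteq> fst f \<and> snd e \<noteq> snd f)"

definition precedes :: "'i list \<Rightarrow> 'i \<Rightarrow> 'i \<Rightarrow> bool" where
  "precedes items i j \<longleftrightarrow> (\<exists>k l. k < l \<and> l < length items \<and> items ! k = i \<and> items ! l = j)"

text \<open>
  The list \<open>es\<close> enumerates the edges in an order in which the greedy algorithm may process them.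
  Edges of different buyers whose samples are equal as draws may come in either order.
\<close>

definition greedy_order ::
  "'i list \<Rightarrow> ('b \<times> 'i) set \<Rightarrow> ('b \<Rightarrow> draw) \<Rightarrow> ('b \<times> 'i) list \<Rightarrow> bool" where
  "greedy_order items E s es \<longleftrightarrow>
     distinct es \<and> set es = E \<and>
     sorted_wrt (\<lambda>(b, i) (b', i'). draw_le (s b') (s b) \<and> (b = b' \<longrightarrow> precedes items i i')) es"

definition greedy_matching :: "('b \<times> 'i) list \<Rightarrow> ('b \<times> 'i) set" where
  "greedy_matching es = fold (\<lambda>e M. if matching (insert e M) then insert e M else M) es {}"

subsection \<open>Prices and the online phase\<close>

text \<open>Draws are almost surely nonnegative in both components, so the price \<open>(0, 0)\<close> of an
  unmatched vertex never excludes anybody, whatever the labels are.\<close>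

definition buyer_price :: "('b \<Rightarrow> draw) \<Rightarrow> ('b \<times> 'i) set \<Rightarrow> 'b \<Rightarrow> draw" where
  "buyer_price s N b = (if \<exists>i. (b, i) \<in> N then s b else (0, 0))"

definition item_price :: "('b \<Rightarrow> draw) \<Rightarrow> ('b \<times> 'i) set \<Rightarrow> 'i \<Rightarrow> draw" where
  "item_price s N i = (if \<exists>b. (b, i) \<in> N then s (THE b. (b, i) \<in> N) else (0, 0))"

definition chosen_item ::
  "'i list \<Rightarrow> ('b \<times> 'i) set \<Rightarrow> ('b \<Rightarrow> draw) \<Rightarrow> ('b \<times> 'i) set \<Rightarrow> 'b \<Rightarrow> draw \<Rightarrow> 'i option" where
  "chosen_item items E s N b rb =
     find (\<lambda>i. (b, i) \<in> E \<and> draw_le (buyer_price s N b) rb \<and> draw_le (item_price s N i) rb)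
       items"

definition online_step ::
  "'i list \<Rightarrow> ('b \<times> 'i) set \<Rightarrow> ('b \<Rightarrow> draw) \<Rightarrow> ('b \<times> 'i) set \<Rightarrow> ('b \<Rightarrow> draw) \<Rightarrow>
     'b \<Rightarrow> ('b \<times> 'i) set \<Rightarrow> ('b \<times> 'i) set" where
  "online_step items E s N r b M =
     (case chosen_item items E s N b (r b) of
        None \<Rightarrow> M
      | Some i \<Rightarrow> if i \<in> snd ` M then M else insert (b, i) M)"

text \<open>\<open>es\<close> is the processing order of the greedy phase, \<open>arr\<close> the arrival order of the buyers.\<close>

definition online_matching ::
  "'i list \<Rightarrow> ('b \<times> 'i) set \<Rightarrow> ('b \<times> 'i) list \<Rightarrow> 'b list \<Rightarrow>
     ('b \<Rightarrow> draw) \<Rightarrow> ('b \<Rightarrow> draw) \<Rightarrow> ('b \<times> 'i) set" where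
  "online_matching items E es arr r s =
     fold (online_step items E s (greedy_matching es) r) arr {}"

definition matching_weight :: "('b \<Rightarrow> draw) \<Rightarrow> ('b \<times> 'i) set \<Rightarrow> real" where
  "matching_weight r M = (\<Sum>(b, i)\<in>M. val (r b))"

subsection \<open>The random experiment\<close>

text \<open>\<open>D b\<close> is the distribution of the value and \<open>U b\<close> that of the label of a draw of buyer
  \<open>b\<close>.  An outcome is a pair \<open>(r, s)\<close> of a reward and a sample for every buyer.\<close>

definition draws :: "'b set \<Rightarrow> ('b \<Rightarrow> real measure) \<Rightarrow> ('b \<Rightarrow> real measure) \<Rightarrow> ('b \<Rightarrow> draw) measure"
  where "draws B D U = (\<Pi>\<^sub>M b\<in>B. D b \<Otimes>\<^sub>M U b)"

definition outcomes ::
  "'b set \<Rightarrow> ('b \<Rightarrow> real measure) \<Rightarrow> ('b \<Rightarrow> real measure) \<Rightarrow>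
     (('b \<Rightarrow> draw) \<times> ('b \<Rightarrow> draw)) measure" where
  "outcomes B D U = draws B D U \<Otimes>\<^sub>M draws B D U"

definition nonneg_distribution :: "real measure \<Rightarrow> bool" where
  "nonneg_distribution N \<longleftrightarrow> prob_space N \<and> sets N = sets borel \<and> (AE x in N. 0 \<le> x)"

definition atomless :: "real measure \<Rightarrow> bool" where
  "atomless N \<longleftrightarrow> (\<forall>x. measure N {x} = 0)"

end

theory Submission
  imports Defs
begin

text \<open>
  Exchanging the reward and the sample of a single buyer preserves the distribution of the
  outcome.  The greedy matching is determined by the rule that every buyer gets the first item
  not taken by a larger sample, so samples below a threshold \<open>x\<close> do not matter for the decisions
  at draws of size at least \<open>x\<close>; and a buyer's reward asks for the item that the same draw would
  have been given as a sample.

  Say that \<open>b\<close> wants \<open>i\<close> if \<open>i\<close> is the item \<open>i\<^sup>*\<close> of \<open>b\<close> in the online phase.  A factor 2 is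
  lost in each of three steps.
  The greedy matching has at least half of the optimal weight.
  If \<open>b\<close> is matched by its sample, then \<open>b\<close> wants an item after exchanging its two draws (if the
  sample is the larger draw) or as things stand (if it is the smaller one), so the greedy weight
  is at most twice the expected total reward of the buyers who want an item.
  If \<open>b\<close> wants \<open>i\<close> but somebody with a smaller reward also does, let \<open>c\<close> be the one with the
  largest such reward; after exchanging the draws of \<open>c\<close>, the item \<open>i\<close> goes to \<open>c\<close> in the greedy
  matching, and \<open>b\<close> is the last to want it.  As \<open>c\<close> can be read off from the result, restricting
  to the smallest reward that wants each item loses at most half.  Whatever the arrival order,
  every item that is wanted is sold for at least this smallest reward.
\<close>

definition draw_lt :: "draw \<Rightarrow> draw \<Rightarrow> bool" where
  "draw_lt x y \<longleftrightarrow> \<not> draw_le y x"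

interpretation draw: linorder draw_le draw_lt
  by unfold_locales (auto simp: draw_le_def draw_lt_def prod_eq_iff)

lemma draw_le_val: "draw_le x y \<Longrightarrow> val x \<le> val y"
  by (auto simp: draw_le_def)

section \<open>The greedy matching as a fixed point\<close>

lemma precedes_asym:
  assumes "distinct items" "precedes items i j" "precedes items j i"
  shows False
  using assms unfolding precedes_def by (metis nth_eq_iff_index_eq less_trans order_less_asym)

text \<open>Puts the search into terms of \<open>precedes\<close>, the relation in which
  \<open>greedy_order\<close> states its tie-breaking.\<close>

lemma find_eq_Some_precedes:
  assumes "distinct items"
  shows "find P items = Some i \<longleftrightarrow>
    i \<in> set items \<and> P i \<and> (\<forall>j\<in>set items. precedes items j i \<longrightarrow> \<not> P j)"
proof
  assume "find P items = Some i"
  then obtain k where k: "k < length items" "P i" "i = items ! k" "\<forall>j<k. \<not> P (items ! j)"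
    by (auto simp: find_Some_iff)
  moreover have "\<not> P j" if "precedes items j i" for j
    using that k assms unfolding precedes_def by (metis nth_eq_iff_index_eq)
  ultimately show "i \<in> set items \<and> P i \<and> (\<forall>j\<in>set items. precedes items j i \<longrightarrow> \<not> P j)"
    by auto
next
  assume R: "i \<in> set items \<and> P i \<and> (\<forall>j\<in>set items. precedes items j i \<longrightarrow> \<not> P j)"
  then obtain k where "k < length items" "items ! k = i"
    by (metis in_set_conv_nth)
  with R show "find P items = Some i"
    unfolding find_Some_iff precedes_def by (metis nth_mem less_trans)
qed

abbreviation greedy_step :: "('b \<times> 'i) \<Rightarrow> ('b \<times> 'i) set \<Rightarrow> ('b \<times> 'i) set" where
  "greedy_step \<equiv> \<lambda>e M. if matching (insert e M) then insert e M else M"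

lemma fold_greedy_step_bounds:
  "M \<subseteq> fold greedy_step es M \<and> fold greedy_step es M \<subseteq> M \<union> set es"
  by (induction es arbitrary: M) (auto split: if_splits, blast+)

lemma matching_fold_greedy_step: "matching M \<Longrightarrow> matching (fold greedy_step es M)"
  by (induction es arbitrary: M) auto

lemma matching_greedy: "matching (greedy_matching es)"
  unfolding greedy_matching_def by (rule matching_fold_greedy_step) (simp add: matching_def)

lemma greedy_matching_subset: "greedy_matching es \<subseteq> set es"
  unfolding greedy_matching_def using fold_greedy_step_bounds[of "{}" es] by auto

text \<open>Accepted edges are never removed, so an absent edge was rejected at its turn, through a
  conflict with an edge accepted earlier that is still there at the end.\<close>

lemma rejected_by_greedy_matching:
  assumes "distinct (pre @ e # post)" "e \<notin> greedy_matching (pre @ e # post)"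
  shows "\<exists>f\<in>greedy_matching (pre @ e # post) \<inter> set pre. fst f = fst e \<or> snd f = snd e"
proof -
  define A where "A = greedy_matching pre"
  define N where "N = greedy_matching (pre @ e # post)"
  have N: "N = fold greedy_step post (greedy_step e A)"
    by (simp add: N_def A_def greedy_matching_def)
  have A: "A \<subseteq> set pre" "matching A"
    by (simp_all add: A_def greedy_matching_subset matching_greedy)
  have step: "greedy_step e A \<subseteq> N"
    using fold_greedy_step_bounds[of "greedy_step e A" post] by (simp add: N)
  have nm: "\<not> matching (insert e A)"
    using step assms(2) unfolding N_def by auto
  then have "A \<subseteq> N"
    using step by simp
  moreover obtain f where "f \<in> A" "fst f = fst e \<or> snd f = snd e"
    using nm A(2) unfolding matching_def by (metis insert_iff)
  ultimately show ?thesis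
    using A(1) unfolding N_def by blast
qed

text \<open>The item that a draw \<open>x\<close> of buyer \<open>b\<close> would ask for, whether it is a sample or a reward.\<close>

definition first_free ::
  "'i list \<Rightarrow> ('b \<times> 'i) set \<Rightarrow> ('b \<Rightarrow> draw) \<Rightarrow> ('b \<times> 'i) set \<Rightarrow> 'b \<Rightarrow> draw \<Rightarrow> 'i option" where
  "first_free items E s N b x =
     find (\<lambda>i. (b, i) \<in> E \<and> (\<forall>b'. (b', i) \<in> N \<longrightarrow> draw_le (s b') x)) items"

locale transversal_graph =
  fixes B :: "'b set" and items :: "'i list" and E :: "('b \<times> 'i) set"
  assumes finite_B: "finite B"
    and distinct_items: "distinct items"
    and E_subset: "E \<subseteq> B \<times> set items"
begin

abbreviation "free \<equiv> first_free items E"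

lemma finite_E: "finite E"
  using finite_B E_subset by (meson finite_SigmaI finite_set finite_subset)

lemma free_eq_Some_iff:
  "free s N b x = Some i \<longleftrightarrow> (b, i) \<in> E \<and> (\<forall>b'. (b', i) \<in> N \<longrightarrow> draw_le (s b') x) \<and>
     (\<forall>j\<in>set items. precedes items j i \<longrightarrow>
        \<not> ((b, j) \<in> E \<and> (\<forall>b'. (b', j) \<in> N \<longrightarrow> draw_le (s b') x)))"
  using E_subset unfolding first_free_def find_eq_Some_precedes[OF distinct_items] by auto

lemma free_eq_None_iff:
  "free s N b x = None \<longleftrightarrow> (\<forall>i. (b, i) \<in> E \<longrightarrow> (\<exists>b'. (b', i) \<in> N \<and> draw_lt x (s b')))"
  using E_subset unfolding first_free_def find_None_iff draw_lt_def by auto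

text \<open>Characterizes the greedy matching without the processing order, by a condition that is
  measurable in \<open>s\<close>. An edge of \<open>b\<close> never blocks \<open>b\<close> itself,
  the comparison being reflexive.\<close>

definition greedy_fixpoint :: "('b \<Rightarrow> draw) \<Rightarrow> ('b \<times> 'i) set \<Rightarrow> bool" where
  "greedy_fixpoint s N \<longleftrightarrow> matching N \<and> N \<subseteq> E \<and>
     (\<forall>e\<in>E. e \<in> N \<longleftrightarrow> free s N (fst e) (s (fst e)) = Some (snd e))"

lemma greedy_fixpoint_mem_iff:
  "greedy_fixpoint s N \<Longrightarrow> (b, i) \<in> N \<longleftrightarrow> free s N b (s b) = Some i"
  unfolding greedy_fixpoint_def using free_eq_Some_iff[of s N b "s b" i] by force

lemma greedy_fixpoint_unique_buyer:
  "greedy_fixpoint s N \<Longrightarrow> (b, i) \<in> N \<Longrightarrow> (b', i) \<in> N \<Longrightarrow> b = b'"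
  unfolding greedy_fixpoint_def matching_def by fastforce

lemma greedy_fixpoint_unique_item:
  "greedy_fixpoint s N \<Longrightarrow> (b, i) \<in> N \<Longrightarrow> (b, j) \<in> N \<Longrightarrow> i = j"
  unfolding greedy_fixpoint_def matching_def by fastforce

lemma greedy_fixpoint_buyer_in: "greedy_fixpoint s N \<Longrightarrow> (b, i) \<in> N \<Longrightarrow> b \<in> B"
  unfolding greedy_fixpoint_def using E_subset by auto

text \<open>A missing edge is blocked by one processed before it: an earlier item of the same buyer,
  or the same item held with a sample at least as large. Injectivity makes the latter comparison
  strict for different buyers.\<close>

lemma greedy_matching_fixpoint:
  assumes s: "inj_on s B" and es: "greedy_order items E s es"
  shows "greedy_fixpoint s (greedy_matching es)"
proof -
  define N where "N = greedy_matching es"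
  have mN: "matching N" and NE: "N \<subseteq> E"
    using es greedy_matching_subset[of es] by (auto simp: N_def matching_greedy greedy_order_def)
  have same_item: "b = b'" if "(b, i) \<in> N" "(b', i) \<in> N" for b b' i
    using mN that unfolding matching_def by fastforce
  have same_buyer: "i = j" if "(b, i) \<in> N" "(b, j) \<in> N" for b i j
    using mN that unfolding matching_def by fastforce
  have blocked: "\<exists>b' k. (b', k) \<in> N \<and> (b' = b \<or> k = i) \<and> draw_le (s b) (s b') \<and>
      (b' = b \<longrightarrow> precedes items k i)" if bi: "(b, i) \<in> E" "(b, i) \<notin> N" for b i
  proof -
    obtain pre post where es': "es = pre @ (b, i) # post"
      using bi(1) es by (metis greedy_order_def split_list)
    have "distinct es"
      using es by (simp add: greedy_order_def)
    then obtain f where f: "f \<in> N" "f \<in> set pre" "fst f = b \<or> snd f = i"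
      using rejected_by_greedy_matching[of pre "(b, i)" post] bi(2) unfolding N_def es' by auto
    have "draw_le (s b) (s (fst f)) \<and> (fst f = b \<longrightarrow> precedes items (snd f) i)"
      using es f(2) unfolding greedy_order_def es' by (fastforce simp: sorted_wrt_append)
    with f show ?thesis
      by (metis prod.collapse)
  qed
  have "(b, i) \<in> N \<longleftrightarrow> free s N b (s b) = Some i" if bi: "(b, i) \<in> E" for b i
  proof
    assume N: "(b, i) \<in> N"
    \<comment> \<open>If an earlier item \<open>j\<close> looked free to \<open>b\<close>, the
      blocker of \<open>(b, j)\<close> would be \<open>(b, i)\<close>, although \<open>i\<close>
      comes after \<open>j\<close>, or another buyer with a sample equal to
      \<open>s b\<close>.\<close>
    have False if j: "precedes items j i" "(b, j) \<in> E" "\<forall>b'. (b', j) \<in> N \<longrightarrow> draw_le (s b') (s b)" for j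
    proof -
      have "j \<noteq> i"
        using j(1) precedes_asym[OF distinct_items] by blast
      then have "(b, j) \<notin> N"
        using N same_buyer by blast
      then obtain b' k where f: "(b', k) \<in> N" "b' = b \<or> k = j"
          and *: "draw_le (s b) (s b')" "b' = b \<longrightarrow> precedes items k j"
        using blocked j(2) by blast
      show False
      proof (cases "b' = b")
        case True
        then show False
          using * f(1) N same_buyer[of b i k] j(1) precedes_asym[OF distinct_items, of i j] by auto
      next
        case False
        then have "s b' = s b"
          using f * j(3) by auto
        moreover have "b \<in> B" "b' \<in> B"
          using f(1) NE E_subset bi by auto
        ultimately show False
          using False s by (meson inj_onD)
      qed
    qed
    then show "free s N b (s b) = Some i"
      using bi N same_item[OF N] unfolding free_eq_Some_iff by blast
  next
    assume F: "free s N b (s b) = Some i"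
    show "(b, i) \<in> N"
    proof (rule ccontr)
      assume "(b, i) \<notin> N"
      then obtain b' k where f: "(b', k) \<in> N" "b' = b \<or> k = i"
          and *: "draw_le (s b) (s b')" "b' = b \<longrightarrow> precedes items k i"
        using blocked bi by blast
      show False
      proof (cases "b' = b")
        case True
        \<comment> \<open>Here the blocker is an earlier item held by \<open>b\<close> itself; it is
          free to \<open>b\<close> and would have been found before \<open>i\<close>.\<close>
        have "k \<in> set items"
          using f(1) NE E_subset by auto
        moreover have "\<forall>c. (c, k) \<in> N \<longrightarrow> draw_le (s c) (s b)"
          using True f(1) same_item[of b k] by blast
        ultimately show False
          using F True * f(1) NE unfolding free_eq_Some_iff by blast
      next
        case False
        then have "s b' = s b"
          using f * F unfolding free_eq_Some_iff by auto
        moreover have "b \<in> B" "b' \<in> B"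
          using f(1) NE E_subset bi by auto
        ultimately show False
          using False s by (meson inj_onD)
      qed
    qed
  qed
  then show ?thesis
    using mN NE unfolding greedy_fixpoint_def N_def by auto
qed

section \<open>Only larger samples influence the item asked for\<close>

text \<open>Only buyers matched with a sample above \<open>y\<close> can block an item at
  \<open>y\<close>.\<close>

lemma free_cong:
  assumes "greedy_fixpoint s N" "greedy_fixpoint s' N'"
    and "\<And>b' j. b' \<in> B \<Longrightarrow> draw_lt y (s b') \<or> draw_lt y (s' b') \<Longrightarrow>
      s b' = s' b' \<and> ((b', j) \<in> N \<longleftrightarrow> (b', j) \<in> N')"
  shows "free s N b y = free s' N' b y"
proof -
  have "(\<forall>b'. (b', i) \<in> N \<longrightarrow> draw_le (s b') y) \<longleftrightarrow> (\<forall>b'. (b', i) \<in> N' \<longrightarrow> draw_le (s' b') y)" for i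
    using assms greedy_fixpoint_buyer_in unfolding draw_lt_def by metis
  then show ?thesis
    unfolding first_free_def by simp
qed

text \<open>Induction from the largest sample downwards: by \<open>free_cong\<close>, the item of
  \<open>b\<close> depends only on the buyers with larger samples.\<close>

lemma greedy_fixpoint_cong_above:
  assumes N: "greedy_fixpoint s N" "greedy_fixpoint s' N'"
    and eq: "\<And>b. b \<in> B \<Longrightarrow> draw_lt x (s b) \<or> draw_lt x (s' b) \<Longrightarrow> s b = s' b"
    and "b \<in> B" "draw_lt x (s b)"
  shows "(b, i) \<in> N \<longleftrightarrow> (b, i) \<in> N'"
  using assms(4,5)
proof (induction "card {b' \<in> B. draw_lt (s b) (s b')}" arbitrary: b i rule: less_induct)
  case less
  have "free s N b (s b) = free s' N' b (s b)"
  proof (rule free_cong[OF N])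
    fix b' j
    assume b': "b' \<in> B" "draw_lt (s b) (s b') \<or> draw_lt (s b) (s' b')"
    then have lt: "draw_lt x (s b') \<or> draw_lt x (s' b')"
      using less.prems(2) draw.less_trans by blast
    then have [simp]: "s b' = s' b'"
      using eq b' by auto
    have "{c \<in> B. draw_lt (s b') (s c)} \<subset> {c \<in> B. draw_lt (s b) (s c)}"
      using b' draw.less_trans by fastforce
    then have "card {c \<in> B. draw_lt (s b') (s c)} < card {c \<in> B. draw_lt (s b) (s c)}"
      using finite_B by (simp add: psubset_card_mono)
    then show "s b' = s' b' \<and> ((b', j) \<in> N \<longleftrightarrow> (b', j) \<in> N')"
      using less.hyps b' lt by simp
  qed
  moreover have "s b = s' b"
    using less.prems eq by blast
  ultimately show ?case
    using N by (simp add: greedy_fixpoint_mem_iff)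
qed

text \<open>Samples may change freely among values not above \<open>x\<close> without affecting a
  draw of size at least \<open>x\<close>. This is what controls the exchange of draws.\<close>

lemma free_cong_above:
  assumes N: "greedy_fixpoint s N" "greedy_fixpoint s' N'"
    and eq: "\<And>b. b \<in> B \<Longrightarrow> draw_lt x (s b) \<or> draw_lt x (s' b) \<Longrightarrow> s b = s' b"
    and "draw_le x y"
  shows "free s N b y = free s' N' b y"
proof (rule free_cong[OF N])
  fix b' j
  assume b': "b' \<in> B" "draw_lt y (s b') \<or> draw_lt y (s' b')"
  then have "draw_lt x (s b') \<or> draw_lt x (s' b')"
    using assms(4) draw.le_less_trans by blast
  then show "s b' = s' b' \<and> ((b', j) \<in> N \<longleftrightarrow> (b', j) \<in> N')"
    using eq b' greedy_fixpoint_cong_above[OF N eq] by metis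
qed

lemma free_mono:
  assumes "free s N b x \<noteq> None" "draw_le x y"
  shows "free s N b y \<noteq> None"
  using assms draw.le_less_trans unfolding free_eq_None_iff by blast

section \<open>Exchanging the two draws of one buyer\<close>

text \<open>The first conjunct is the test against the buyer's price, while \<open>free\<close>
  carries the test against the item prices.\<close>

definition wants :: "('b \<Rightarrow> draw) \<Rightarrow> ('b \<Rightarrow> draw) \<Rightarrow> ('b \<times> 'i) set \<Rightarrow> 'b \<Rightarrow> 'i \<Rightarrow> bool" where
  "wants r s N b i \<longleftrightarrow> (b \<in> fst ` N \<longrightarrow> draw_le (s b) (r b)) \<and> free s N b (r b) = Some i"

text \<open>Last in decreasing order of reward, not in the order of arrival.\<close>

definition last_wants :: "('b \<Rightarrow> draw) \<Rightarrow> ('b \<Rightarrow> draw) \<Rightarrow> ('b \<times> 'i) set \<Rightarrow> 'b \<Rightarrow> 'i \<Rightarrow> bool" where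
  "last_wants r s N b i \<longleftrightarrow>
     wants r s N b i \<and> (\<forall>b'\<in>B. wants r s N b' i \<longrightarrow> draw_le (r b) (r b'))"

text \<open>The almost sure properties behind the deterministic arguments. Separating rewards from
  samples across buyers as well makes the condition stable under exchanging the draws of one
  buyer.\<close>

definition generic :: "('b \<Rightarrow> draw) \<Rightarrow> ('b \<Rightarrow> draw) \<Rightarrow> bool" where
  "generic r s \<longleftrightarrow>
     (\<forall>b\<in>B. \<forall>b'\<in>B. (b \<noteq> b' \<longrightarrow> r b \<noteq> r b' \<and> s b \<noteq> s b') \<and> r b \<noteq> s b') \<and>
     (\<forall>b\<in>B. draw_le (0, 0) (r b) \<and> draw_le (0, 0) (s b))"

lemma generic_swap:
  "b \<in> B \<Longrightarrow> generic r s \<Longrightarrow> generic (r(b := s b)) (s(b := r b))"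
  unfolding generic_def by (auto, metis+)

lemma generic_flip: "generic r s \<Longrightarrow> generic s r"
  unfolding generic_def by metis

lemma generic_nonneg: "generic r s \<Longrightarrow> b \<in> B \<Longrightarrow> 0 \<le> val (r b)"
  using draw_le_val[of "(0, 0)" "r b"] by (simp add: generic_def)

lemma generic_inj: "generic r s \<Longrightarrow> inj_on s B"
  unfolding generic_def inj_on_def by metis

lemma wants_buyer_in: "wants r s N b i \<Longrightarrow> b \<in> B"
  unfolding wants_def free_eq_Some_iff using E_subset by auto

text \<open>Were the sample larger, it would find an item because the reward does, so
  \<open>b\<close> would be matched and its price would exclude its reward.\<close>

lemma wants_gt_sample:
  assumes N: "greedy_fixpoint s N" and g: "generic r s" and w: "wants r s N b i"
  shows "draw_lt (s b) (r b)"
proof (rule ccontr)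
  assume "\<not> draw_lt (s b) (r b)"
  moreover have "r b \<noteq> s b"
    using g wants_buyer_in[OF w] unfolding generic_def by blast
  ultimately have lt: "draw_lt (r b) (s b)"
    by auto
  then have "free s N b (s b) \<noteq> None"
    using w free_mono unfolding wants_def by (metis draw.less_imp_le option.distinct(1))
  then have "b \<in> fst ` N"
    using greedy_fixpoint_mem_iff[OF N] by (metis fst_conv image_eqI not_None_eq)
  with w lt show False
    unfolding wants_def by auto
qed

text \<open>The only sample that changes goes from \<open>s b\<close> down to \<open>r b\<close>, so
  \<open>s b\<close> finds as a reward the item that it took as a sample.\<close>

lemma matched_imp_wants_swap:
  assumes N: "greedy_fixpoint s N" and N': "greedy_fixpoint (s(b := r b)) N'"
    and m: "(b, i) \<in> N" and lt: "draw_lt (r b) (s b)"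
  shows "wants (r(b := s b)) (s(b := r b)) N' b i"
proof -
  have "free s N b (s b) = free (s(b := r b)) N' b (s b)"
    by (rule free_cong_above[OF N N', where x = "s b"]) (use lt in \<open>auto split: if_splits\<close>)
  then show ?thesis
    using m lt greedy_fixpoint_mem_iff[OF N] unfolding wants_def by auto
qed

text \<open>The reward may find an earlier item than the sample did, hence the existential.\<close>

lemma matched_imp_wants:
  assumes N: "greedy_fixpoint s N" and m: "(b, i) \<in> N" and le: "draw_le (s b) (r b)"
  shows "\<exists>j. wants r s N b j"
  using free_mono[of s N b "s b" "r b"] m le greedy_fixpoint_mem_iff[OF N, of b i]
  unfolding wants_def by auto

text \<open>If \<open>b\<close> is not the last buyer wanting \<open>i\<close>, turning the reward of the next one into a sample
  makes that sample take \<open>i\<close> in the greedy matching, without changing what happens above it.\<close>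

lemma wants_imp_last_wants_swap:
  assumes N: "\<And>s. inj_on s B \<Longrightarrow> greedy_fixpoint s (N s)"
    and g: "generic r s" and w: "wants r s (N s) b i" and nl: "\<not> last_wants r s (N s) b i"
  shows "\<exists>c\<in>B - {b}. last_wants (r(c := s c)) (s(c := r c)) (N (s(c := r c))) b i \<and>
    (c, i) \<in> N (s(c := r c))"
proof -
  define C where "C = {c \<in> B. wants r s (N s) c i \<and> draw_lt (r c) (r b)}"
  have "finite (r ` C)" "r ` C \<noteq> {}"
    using nl w finite_B unfolding last_wants_def C_def draw_lt_def by auto
  then have "draw.Max (r ` C) \<in> r ` C" and "\<forall>c\<in>C. draw_le (r c) (draw.Max (r ` C))"
    by (auto intro: draw.Max_in draw.Max_ge)
  then obtain c where c: "c \<in> C" and max: "\<And>d. d \<in> C \<Longrightarrow> draw_le (r d) (r c)"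
    by auto
  have cB: "c \<in> B" and wc: "wants r s (N s) c i" and lt: "draw_lt (r c) (r b)"
    using c by (auto simp: C_def)
  have cb: "c \<noteq> b"
    using lt by auto
  define r' s' where "r' = r(c := s c)" and "s' = s(c := r c)"
  have g': "generic r' s'"
    unfolding r'_def s'_def by (rule generic_swap[OF cB g])
  have F: "greedy_fixpoint s (N s)" and F': "greedy_fixpoint s' (N s')"
    using N generic_inj g g' by blast+
  have sc: "draw_lt (s c) (r c)"
    by (rule wants_gt_sample[OF F g wc])
  \<comment> \<open>Neither the old sample \<open>s c\<close> nor the new sample \<open>r c\<close>
    of \<open>c\<close> exceeds \<open>r c\<close>, so nothing changes for draws from
    \<open>r c\<close> upwards.\<close>
  have free: "free s (N s) d y = free s' (N s') d y" if "draw_le (r c) y" for d y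
    by (rule free_cong_above[OF F F' _ that]) (use sc in \<open>auto simp: s'_def split: if_splits\<close>)
  have ci: "(c, i) \<in> N s'"
    using free[of "r c" c] wc greedy_fixpoint_mem_iff[OF F'] by (auto simp: wants_def s'_def)
  have wb: "wants r' s' (N s') b i"
    using free[of "r b" b] lt w wants_gt_sample[OF F g w] cb
    by (auto simp: wants_def s'_def r'_def)
  have "draw_le (r' b) (r' d)" if d: "d \<in> B" "wants r' s' (N s') d i" for d
  proof (rule ccontr)
    assume *: "\<not> draw_le (r' b) (r' d)"
    \<comment> \<open>After the exchange \<open>c\<close> holds \<open>i\<close> with sample
      \<open>r c\<close>, a lower bound for the reward of everybody wanting \<open>i\<close>. This
      rules out \<open>d = c\<close>, whose reward is now the smaller \<open>s c\<close>.\<close>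
    have "draw_le (r c) (r' d)"
      using d(2) ci unfolding wants_def free_eq_Some_iff by (auto simp: s'_def)
    with sc have dc: "d \<noteq> c"
      by (auto simp: r'_def)
    with \<open>draw_le (r c) (r' d)\<close> have le: "draw_le (r c) (r d)"
      by (simp add: r'_def)
    have "r c \<noteq> r d"
      using generic_inj[OF generic_flip[OF g]] dc cB d(1) by (metis inj_onD)
    with le have less: "draw_lt (r c) (r d)"
      by (rule draw.le_neq_trans)
    \<comment> \<open>So \<open>d\<close> already wanted \<open>i\<close> before the exchange, with
      a reward between those of \<open>c\<close> and \<open>b\<close>, against the choice of
      \<open>c\<close>.\<close>
    have "wants r s (N s) d i"
      using free[OF le, of d] d(2) wants_gt_sample[OF F' g' d(2)] dc
      by (simp add: wants_def s'_def r'_def draw.less_imp_le)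
    then have "d \<in> C"
      using * d(1) dc cb by (auto simp: C_def r'_def)
    then show False
      using max[of d] less by (simp add: draw_lt_def)
  qed
  with wb ci cB cb show ?thesis
    unfolding last_wants_def r'_def s'_def by blast
qed

section \<open>The two deterministic bounds\<close>

text \<open>A buyer \<open>b\<close> of \<open>T\<close> that greedy leaves out is charged to the
  holder of \<open>m b\<close>, whose sample is larger. As \<open>m\<close> is injective, each
  matched buyer is charged at most once; the matched buyers of \<open>T\<close> account for the
  other half.\<close>

lemma offline_opt_le_greedy:
  assumes N: "greedy_fixpoint s N" and pos: "\<And>b. b \<in> B \<Longrightarrow> 0 \<le> val (s b)"
  shows "offline_opt B E s \<le> 2 * (\<Sum>b\<in>fst ` N. val (s b))"
proof -
  have NB: "fst ` N \<subseteq> B"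
    using greedy_fixpoint_buyer_in[OF N] by auto
  then have fin: "finite (fst ` N)"
    using finite_B finite_subset by blast
  have "(\<Sum>b\<in>T. val (s b)) \<le> 2 * (\<Sum>b\<in>fst ` N. val (s b))" if T: "transversal_indep B E T" for T
  proof -
    obtain m where m: "inj_on m T" "\<forall>b\<in>T. (b, m b) \<in> E" and TB: "T \<subseteq> B"
      using T by (auto simp: transversal_indep_def)
    have finT: "finite T"
      using TB finite_B finite_subset by blast
    have "(\<Sum>b\<in>T \<inter> fst ` N. val (s b)) \<le> (\<Sum>b\<in>fst ` N. val (s b))"
      using fin NB pos by (intro sum_mono2) auto
    moreover have "(\<Sum>b\<in>T - fst ` N. val (s b)) \<le> (\<Sum>b\<in>fst ` N. val (s b))"
    proof (rule sum_le_included[where i = "\<lambda>c. THE b. b \<in> T \<and> (c, m b) \<in> N"])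
      show "\<forall>b\<in>T - fst ` N. \<exists>c\<in>fst ` N. (THE b. b \<in> T \<and> (c, m b) \<in> N) = b \<and> val (s b) \<le> val (s c)"
      proof
        fix b
        assume b: "b \<in> T - fst ` N"
        then have "free s N b (s b) = None"
          using greedy_fixpoint_mem_iff[OF N] by (metis DiffD2 fst_conv image_eqI not_None_eq)
        then obtain c where c: "(c, m b) \<in> N" "draw_lt (s b) (s c)"
          using b m(2) unfolding free_eq_None_iff by blast
        have "(THE b. b \<in> T \<and> (c, m b) \<in> N) = b"
          using b c(1) m(1) greedy_fixpoint_unique_item[OF N] by (intro the_equality) (auto dest: inj_onD)
        then show "\<exists>c\<in>fst ` N. (THE b. b \<in> T \<and> (c, m b) \<in> N) = b \<and> val (s b) \<le> val (s c)"
          using c(1) draw_le_val[OF draw.less_imp_le[OF c(2)]] by (intro bexI[of _ c]) (auto intro: rev_image_eqI)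
      qed
    qed (use fin finT NB pos in auto)
    ultimately show ?thesis
      using sum.Int_Diff[OF finT, of "\<lambda>b. val (s b)" "fst ` N"] by linarith
  qed
  moreover have "finite {T. transversal_indep B E T}"
    using finite_B by (rule finite_subset[rotated, OF finite_Pow_iff[THEN iffD2]])
      (auto simp: transversal_indep_def)
  moreover have "transversal_indep B E {}"
    by (simp add: transversal_indep_def)
  ultimately show ?thesis
    unfolding offline_opt_def by (subst Max_le_iff) auto
qed

text \<open>The default price \<open>(0, 0)\<close> never exceeds a nonnegative reward, which
  matches the vacuous condition in \<open>free\<close> for an unmatched item. The price of a matched
  item is the sample of its unique holder.\<close>

lemma chosen_item_eq_Some_iff:
  assumes N: "greedy_fixpoint s N" and pos: "draw_le (0, 0) (r b)"
  shows "chosen_item items E s N b (r b) = Some i \<longleftrightarrow> wants r s N b i"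
proof -
  have the_buyer: "(THE b. (b, j) \<in> N) = c" if "(c, j) \<in> N" for c j
    using that greedy_fixpoint_unique_buyer[OF N] by blast
  have "draw_le (item_price s N j) (r b) \<longleftrightarrow> (\<forall>b'. (b', j) \<in> N \<longrightarrow> draw_le (s b') (r b))" for j
    using pos the_buyer by (auto simp: item_price_def)
  moreover have "draw_le (buyer_price s N b) (r b) \<longleftrightarrow> (b \<in> fst ` N \<longrightarrow> draw_le (s b) (r b))"
    using pos by (force simp: buyer_price_def)
  ultimately show ?thesis
    unfolding chosen_item_def wants_def first_free_def find_eq_Some_precedes[OF distinct_items]
    by auto
qed

end

text \<open>On arrival a buyer either gets its chosen item or finds it already sold; in both cases
  the item is sold from then on.\<close>

lemma fold_online_step:
  fixes items E s N r arr
  defines "ch \<equiv> \<lambda>b. chosen_item items E s N b (r b)"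
    and "M \<equiv> fold (online_step items E s N r) arr {}"
  shows "M \<subseteq> {(b, i). b \<in> set arr \<and> ch b = Some i} \<and>
    (\<forall>b i. b \<in> set arr \<longrightarrow> ch b = Some i \<longrightarrow> i \<in> snd ` M)"
  unfolding M_def
proof (induction arr rule: rev_induct)
  case (snoc b arr)
  then show ?case
    by (auto simp: online_step_def ch_def split: option.split)
qed auto

context transversal_graph
begin

text \<open>The item that \<open>b\<close> is the last to want is sold to somebody who wants it,
  hence for at least \<open>r b\<close>. Since rewards are distinct, the item determines
  \<open>b\<close>, so no sale is counted twice.\<close>

lemma last_wants_le_online:
  assumes N: "greedy_fixpoint s (greedy_matching es)" and g: "generic r s" and arr: "set arr = B"
  shows "(\<Sum>b | b \<in> B \<and> (\<exists>i. last_wants r s (greedy_matching es) b i). val (r b))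
    \<le> matching_weight r (online_matching items E es arr r s)"
proof -
  define L where "L = last_wants r s (greedy_matching es)"
  define M where "M = online_matching items E es arr r s"
  have pos: "draw_le (0, 0) (r b)" if "b \<in> B" for b
    using g that unfolding generic_def by blast
  have ch: "chosen_item items E s (greedy_matching es) b (r b) = Some i \<longleftrightarrow>
      wants r s (greedy_matching es) b i" if "b \<in> B" for b i
    using chosen_item_eq_Some_iff[OF N] pos[OF that] by blast
  have M: "M \<subseteq> {(b, i). b \<in> B \<and> wants r s (greedy_matching es) b i}"
      "\<And>b i. b \<in> B \<Longrightarrow> wants r s (greedy_matching es) b i \<Longrightarrow> i \<in> snd ` M"
    using fold_online_step[of items E s "greedy_matching es" r arr] ch
    unfolding M_def online_matching_def arr by blast+
  have "M \<subseteq> E"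
    using M(1) by (auto simp: wants_def free_eq_Some_iff)
  then have finM: "finite M"
    using finite_E finite_subset by blast
  have "(\<Sum>b | b \<in> B \<and> (\<exists>i. L b i). val (r b)) \<le> (\<Sum>e\<in>M. val (r (fst e)))"
  proof (rule sum_le_included[where i = "\<lambda>e. THE b. b \<in> B \<and> L b (snd e)"])
    show "\<forall>b\<in>{b \<in> B. \<exists>i. L b i}. \<exists>e\<in>M. (THE b. b \<in> B \<and> L b (snd e)) = b \<and>
      val (r b) \<le> val (r (fst e))"
    proof
      fix b
      assume "b \<in> {b \<in> B. \<exists>i. L b i}"
      then obtain i where b: "b \<in> B" and i: "L b i" by blast
      then obtain c where c: "(c, i) \<in> M"
        using M(2)[of b i] unfolding L_def last_wants_def by auto
      have "draw_le (r b) (r c)"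
        using c M(1) i unfolding L_def last_wants_def by blast
      moreover have "(THE b. b \<in> B \<and> L b i) = b"
      proof (rule the_equality)
        fix d
        assume d: "d \<in> B \<and> L d i"
        with i b have "r d = r b"
          unfolding L_def last_wants_def by (meson draw.order.antisym)
        then show "d = b"
          using d b generic_inj[OF generic_flip[OF g]] by (auto dest: inj_onD)
      qed (use b i in simp)
      ultimately show "\<exists>e\<in>M. (THE b. b \<in> B \<and> L b (snd e)) = b \<and> val (r b) \<le> val (r (fst e))"
        using c draw_le_val by (intro bexI[of _ "(c, i)"]) simp_all
    qed
    show "\<forall>e\<in>M. 0 \<le> val (r (fst e))"
    proof
      fix e
      assume "e \<in> M"
      then have "fst e \<in> B"
        using M(1) by auto
      then show "0 \<le> val (r (fst e))"
        using draw_le_val[OF pos] by simp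
    qed
  qed (use finite_B finM in simp_all)
  also have "\<dots> = matching_weight r M"
    unfolding matching_weight_def by (simp add: case_prod_unfold)
  finally show ?thesis
    unfolding L_def M_def .
qed

end

section \<open>The random experiment\<close>

text \<open>\<open>D\<close> and \<open>U\<close> are constrained at all indices, also outside
  \<open>B\<close>, because \<open>product_sigma_finite\<close> speaks of a family over the whole
  type. The order of the edges is an arbitrary function of the samples.\<close>

locale sampled_graph = transversal_graph B items E
  for B :: "'b set" and items :: "'i list" and E :: "('b \<times> 'i) set" +
  fixes D U :: "'b \<Rightarrow> real measure" and edge_order :: "('b \<Rightarrow> draw) \<Rightarrow> ('b \<times> 'i) list"
  assumes D: "\<And>b. nonneg_distribution (D b)"
    and U: "\<And>b. nonneg_distribution (U b)"
    and atomless: "\<And>b. b \<in> B \<Longrightarrow> atomless (D b) \<or> atomless (U b)"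
    and edge_order: "\<And>s. greedy_order items E s (edge_order s)"
begin

abbreviation "K b \<equiv> D b \<Otimes>\<^sub>M U b"
abbreviation "P \<equiv> draws B D U"
abbreviation "\<Omega> \<equiv> outcomes B D U"

lemma prob_D: "prob_space (D b)" and prob_U: "prob_space (U b)"
  and sets_D: "sets (D b) = sets borel" and sets_U: "sets (U b) = sets borel"
  using D U unfolding nonneg_distribution_def by auto

lemma prob_K: "prob_space (K b)"
proof -
  interpret D: prob_space "D b" by (rule prob_D)
  interpret U: prob_space "U b" by (rule prob_U)
  interpret pair_prob_space "D b" "U b" ..
  show ?thesis by unfold_locales
qed

sublocale K: product_sigma_finite K
  by (rule product_sigma_finite.intro) (rule prob_space_imp_sigma_finite[OF prob_K])

lemma sets_K: "sets (K b) = sets (borel \<Otimes>\<^sub>M borel)"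
  by (intro sets_pair_measure_cong sets_D sets_U)

sublocale P: prob_space P
  unfolding draws_def by (rule prob_space_PiM) (rule prob_K)

sublocale PP: pair_prob_space P P ..

lemma measurable_draw [measurable]: "b \<in> B \<Longrightarrow> (\<lambda>r. r b) \<in> P \<rightarrow>\<^sub>M borel \<Otimes>\<^sub>M borel"
  unfolding draws_def using measurable_component_singleton[of b B K] sets_K
  by (simp cong: measurable_cong_sets)

lemma measurable_reward [measurable]: "b \<in> B \<Longrightarrow> (\<lambda>\<omega>. fst \<omega> b) \<in> \<Omega> \<rightarrow>\<^sub>M borel \<Otimes>\<^sub>M borel"
  and measurable_sample [measurable]: "b \<in> B \<Longrightarrow> (\<lambda>\<omega>. snd \<omega> b) \<in> \<Omega> \<rightarrow>\<^sub>M borel \<Otimes>\<^sub>M borel"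
  unfolding outcomes_def by measurable

section \<open>Invariance under exchanging the two draws of one buyer\<close>

definition swap :: "'b \<Rightarrow> ('b \<Rightarrow> draw) \<times> ('b \<Rightarrow> draw) \<Rightarrow> ('b \<Rightarrow> draw) \<times> ('b \<Rightarrow> draw)" where
  "swap b = (\<lambda>(r, s). (r(b := s b), s(b := r b)))"

lemma measurable_swap [measurable]:
  assumes b: "b \<in> B"
  shows "swap b \<in> \<Omega> \<rightarrow>\<^sub>M \<Omega>"
proof -
  have [measurable]: "(\<lambda>x. x b) \<in> P \<rightarrow>\<^sub>M K b"
    using b unfolding draws_def by measurable
  have [measurable]: "(\<lambda>(r, x). r(b := x)) \<in> P \<Otimes>\<^sub>M K b \<rightarrow>\<^sub>M P"
    unfolding draws_def case_prod_unfold
    by (rule measurable_fun_upd[of _ B]) (use b in auto)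
  have "(\<lambda>(r, s). (case (r, s b) of (r, x) \<Rightarrow> r(b := x), case (s, r b) of (r, x) \<Rightarrow> r(b := x)))
      \<in> \<Omega> \<rightarrow>\<^sub>M \<Omega>"
    unfolding outcomes_def by measurable
  then show ?thesis
    by (simp add: swap_def)
qed

text \<open>Both sides are integrals over the two draws of buyer \<open>b\<close> of the same iterated integral over
  the remaining draws, with the two variables exchanged.\<close>

lemma nn_integral_swap:
  assumes b: "b \<in> B" and f: "f \<in> borel_measurable \<Omega>"
  shows "(\<integral>\<^sup>+\<omega>. f (swap b \<omega>) \<partial>\<Omega>) = (\<integral>\<^sup>+\<omega>. f \<omega> \<partial>\<Omega>)"
proof -
  define Q where "Q = PiM (B - {b}) K"
  have B: "insert b (B - {b}) = B"
    using b by auto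
  interpret Q: prob_space Q
    unfolding Q_def by (rule prob_space_PiM) (rule prob_K)
  interpret Kb: prob_space "K b" by (rule prob_K)
  interpret QK: pair_sigma_finite Q "K b" ..
  interpret KQ: pair_sigma_finite "K b" Q ..
  interpret KK: pair_sigma_finite "K b" "K b" ..
  have u: "(\<lambda>p. (fst p)(b := snd p)) \<in> Q \<Otimes>\<^sub>M K b \<rightarrow>\<^sub>M P"
    unfolding draws_def Q_def by (rule measurable_fun_upd[of _ "B - {b}"]) (use b in auto)
  define J where "J f x y = (\<integral>\<^sup>+r. \<integral>\<^sup>+s. f (r(b := x), s(b := y)) \<partial>Q \<partial>Q)"
    for f :: "('b \<Rightarrow> draw) \<times> ('b \<Rightarrow> draw) \<Rightarrow> ennreal" and x y
  have meas: "(\<lambda>(r, x, s, y). f (r(b := x), s(b := y))) \<in> borel_measurable (Q \<Otimes>\<^sub>M K b \<Otimes>\<^sub>M Q \<Otimes>\<^sub>M K b)"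
    if "f \<in> borel_measurable \<Omega>" for f :: "('b \<Rightarrow> draw) \<times> ('b \<Rightarrow> draw) \<Rightarrow> ennreal"
  proof -
    have "(\<lambda>w. ((\<lambda>p. (fst p)(b := snd p)) (fst w, fst (snd w)), (\<lambda>p. (fst p)(b := snd p)) (snd (snd w))))
        \<in> Q \<Otimes>\<^sub>M K b \<Otimes>\<^sub>M Q \<Otimes>\<^sub>M K b \<rightarrow>\<^sub>M \<Omega>"
      unfolding outcomes_def
      by (intro measurable_Pair measurable_compose[OF _ u]) measurable
    from measurable_compose[OF this that] show ?thesis
      by (simp add: case_prod_unfold)
  qed
  have split: "(\<integral>\<^sup>+\<omega>. f \<omega> \<partial>\<Omega>) = (\<integral>\<^sup>+x. \<integral>\<^sup>+y. J f x y \<partial>K b \<partial>K b)"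
    and J: "case_prod (J f) \<in> borel_measurable (K b \<Otimes>\<^sub>M K b)"
    if f: "f \<in> borel_measurable \<Omega>" for f
  proof -
    define h where "h r x s y = f (r(b := x), s(b := y))" for r x s y
    have h [measurable]: "(\<lambda>(r, x, s, y). h r x s y) \<in> borel_measurable (Q \<Otimes>\<^sub>M K b \<Otimes>\<^sub>M Q \<Otimes>\<^sub>M K b)"
      using meas[OF f] by (simp add: h_def)
    have [measurable (raw)]: "(\<lambda>w. h (r w) (x w) (s w) (y w)) \<in> borel_measurable M"
      if "r \<in> M \<rightarrow>\<^sub>M Q" "x \<in> M \<rightarrow>\<^sub>M K b" "s \<in> M \<rightarrow>\<^sub>M Q" "y \<in> M \<rightarrow>\<^sub>M K b" for M r x s y
      using measurable_compose[OF measurable_Pair[OF that(1) measurable_Pair[OF that(2)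
        measurable_Pair[OF that(3,4)]]] h] by simp
    have f' [measurable]: "f \<in> borel_measurable (P \<Otimes>\<^sub>M P)"
      using f by (simp add: outcomes_def)
    have ins: "(\<integral>\<^sup>+r. g r \<partial>P) = (\<integral>\<^sup>+r. \<integral>\<^sup>+x. g (r(b := x)) \<partial>K b \<partial>Q)"
      if "g \<in> borel_measurable P" for g
      using K.product_nn_integral_insert[of "B - {b}" b g] that finite_B
      unfolding draws_def Q_def B by simp
    have "(\<integral>\<^sup>+\<omega>. f \<omega> \<partial>\<Omega>) = (\<integral>\<^sup>+r. \<integral>\<^sup>+s. f (r, s) \<partial>P \<partial>P)"
      unfolding outcomes_def by (rule P.nn_integral_fst[symmetric]) fact
    also have "\<dots> = (\<integral>\<^sup>+r. \<integral>\<^sup>+x. (\<integral>\<^sup>+s. f (r(b := x), s) \<partial>P) \<partial>K b \<partial>Q)"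
      by (rule ins) measurable
    also have "\<dots> = (\<integral>\<^sup>+r. \<integral>\<^sup>+x. \<integral>\<^sup>+s. \<integral>\<^sup>+y. h r x s y \<partial>K b \<partial>Q \<partial>K b \<partial>Q)"
    proof (intro nn_integral_cong)
      fix r x
      assume "r \<in> space Q" "x \<in> space (K b)"
      then have "r(b := x) \<in> space P"
        using measurable_space[OF u, of "(r, x)"] by (simp add: space_pair_measure)
      then show "(\<integral>\<^sup>+s. f (r(b := x), s) \<partial>P) = (\<integral>\<^sup>+s. \<integral>\<^sup>+y. h r x s y \<partial>K b \<partial>Q)"
        unfolding h_def by (intro ins) measurable
    qed
    \<comment> \<open>Fubini, applied three times, moves the two draws of \<open>b\<close>
      outermost.\<close>
    also have "\<dots> = (\<integral>\<^sup>+x. \<integral>\<^sup>+r. \<integral>\<^sup>+s. \<integral>\<^sup>+y. h r x s y \<partial>K b \<partial>Q \<partial>Q \<partial>K b)"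
      by (rule KQ.Fubini') measurable
    also have "\<dots> = (\<integral>\<^sup>+x. \<integral>\<^sup>+r. \<integral>\<^sup>+y. \<integral>\<^sup>+s. h r x s y \<partial>Q \<partial>K b \<partial>Q \<partial>K b)"
      by (intro nn_integral_cong KQ.Fubini') measurable
    also have "\<dots> = (\<integral>\<^sup>+x. \<integral>\<^sup>+y. \<integral>\<^sup>+r. \<integral>\<^sup>+s. h r x s y \<partial>Q \<partial>Q \<partial>K b \<partial>K b)"
      by (intro nn_integral_cong KQ.Fubini') measurable
    finally show "(\<integral>\<^sup>+\<omega>. f \<omega> \<partial>\<Omega>) = (\<integral>\<^sup>+x. \<integral>\<^sup>+y. J f x y \<partial>K b \<partial>K b)"
      unfolding J_def h_def .
    show "case_prod (J f) \<in> borel_measurable (K b \<Otimes>\<^sub>M K b)"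
      unfolding J_def h_def[symmetric] by measurable
  qed
  have "(\<integral>\<^sup>+\<omega>. f (swap b \<omega>) \<partial>\<Omega>) = (\<integral>\<^sup>+x. \<integral>\<^sup>+y. J (\<lambda>\<omega>. f (swap b \<omega>)) x y \<partial>K b \<partial>K b)"
    by (rule split) (use f b in measurable)
  also have "\<dots> = (\<integral>\<^sup>+x. \<integral>\<^sup>+y. J f y x \<partial>K b \<partial>K b)"
    by (simp add: J_def swap_def)
  also have "\<dots> = (\<integral>\<^sup>+x. \<integral>\<^sup>+y. J f x y \<partial>K b \<partial>K b)"
    by (rule KK.Fubini'[OF J[OF f]])
  also have "\<dots> = (\<integral>\<^sup>+\<omega>. f \<omega> \<partial>\<Omega>)"
    by (rule split[OF f, symmetric])
  finally show ?thesis .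
qed

text \<open>The indicator of the exceptional set has integral 0, and the exchange preserves this
  integral.\<close>

lemma AE_swap:
  assumes b: "b \<in> B" and ae: "AE \<omega> in \<Omega>. Q \<omega>" and Q: "Measurable.pred \<Omega> Q"
  shows "AE \<omega> in \<Omega>. Q (swap b \<omega>)"
proof -
  note [measurable] = Q measurable_swap[OF b]
  have "(\<integral>\<^sup>+\<omega>. indicator {\<omega> \<in> space \<Omega>. \<not> Q \<omega>} (swap b \<omega>) \<partial>\<Omega>) =
      (\<integral>\<^sup>+\<omega>. indicator {\<omega> \<in> space \<Omega>. \<not> Q \<omega>} \<omega> \<partial>\<Omega>)"
    by (rule nn_integral_swap[OF b]) measurable
  also have "\<dots> = (\<integral>\<^sup>+\<omega>. 0 \<partial>\<Omega>)"
    using ae by (intro nn_integral_cong_AE) (auto elim!: eventually_mono)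
  finally have "(\<integral>\<^sup>+\<omega>. indicator {\<omega> \<in> space \<Omega>. \<not> Q \<omega>} (swap b \<omega>) \<partial>\<Omega>) = 0"
    by simp
  then have "AE \<omega> in \<Omega>. indicator {\<omega> \<in> space \<Omega>. \<not> Q \<omega>} (swap b \<omega>) = (0::ennreal)"
    by (rule nn_integral_0_iff_AE[THEN iffD1, rotated]) measurable
  then show ?thesis
    using measurable_space[OF measurable_swap[OF b]]
    by (auto simp: indicator_def elim!: AE_mp split: if_splits)
qed

section \<open>Generic outcomes\<close>

lemma pred_draw_eq [measurable (raw)]:
  assumes [measurable]: "f \<in> M \<rightarrow>\<^sub>M borel \<Otimes>\<^sub>M borel" "g \<in> M \<rightarrow>\<^sub>M borel \<Otimes>\<^sub>M borel"
  shows "Measurable.pred M (\<lambda>\<omega>. (f \<omega> :: draw) = g \<omega>)"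
  unfolding prod_eq_iff by measurable

lemma pred_draw_le [measurable (raw)]:
  assumes [measurable]: "f \<in> M \<rightarrow>\<^sub>M borel \<Otimes>\<^sub>M borel" "g \<in> M \<rightarrow>\<^sub>M borel \<Otimes>\<^sub>M borel"
  shows "Measurable.pred M (\<lambda>\<omega>. draw_le (f \<omega>) (g \<omega>))"
  unfolding draw_le_def by measurable

text \<open>The mass of a point is the product of the masses of its coordinates, and one factor
  vanishes.\<close>

lemma AE_K_neq:
  assumes "b \<in> B"
  shows "AE x in K b. x \<noteq> p"
proof -
  interpret D: prob_space "D b" by (rule prob_D)
  interpret U: prob_space "U b" by (rule prob_U)
  have s: "{fst p} \<in> sets (D b)" "{snd p} \<in> sets (U b)"
    by (simp_all add: sets_D sets_U)
  have "emeasure (K b) ({fst p} \<times> {snd p}) = emeasure (D b) {fst p} * emeasure (U b) {snd p}"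
    by (rule U.emeasure_pair_measure_Times[OF s])
  also have "\<dots> = 0"
    using atomless[OF assms] by (auto simp: atomless_def D.emeasure_eq_measure U.emeasure_eq_measure)
  finally have "{p} \<in> null_sets (K b)"
    using s by (auto intro!: null_setsI simp: pair_measureI[of "{fst p}" _ "{snd p}", simplified])
  from AE_not_in[OF this] show ?thesis
    by simp
qed

lemma AE_component: "b \<in> B \<Longrightarrow> AE x in K b. Q x \<Longrightarrow> AE r in P. Q (r b)"
  unfolding draws_def by (rule AE_PiM_component) (use prob_K in auto)

text \<open>A sample almost surely avoids any fixed reward, so rewards differ from samples.
  Exchanging the draws of one buyer turns this into distinctness among rewards and among
  samples.\<close>

lemma AE_generic: "AE (r, s) in \<Omega>. generic r s"
proof -
  have rs: "AE \<omega> in \<Omega>. fst \<omega> b \<noteq> snd \<omega> c" if [measurable]: "b \<in> B" "c \<in> B" for b c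
    unfolding outcomes_def
  proof (rule PP.AE_pair_measure)
    show "{\<omega> \<in> space (P \<Otimes>\<^sub>M P). fst \<omega> b \<noteq> snd \<omega> c} \<in> sets (P \<Otimes>\<^sub>M P)"
      by measurable
    show "AE r in P. AE s in P. fst (r, s) b \<noteq> snd (r, s) c"
      using AE_component[OF that(2) AE_K_neq[OF that(2)]] by (auto simp: eq_commute)
  qed
  have rr: "AE \<omega> in \<Omega>. fst \<omega> b \<noteq> fst \<omega> c" if [measurable]: "b \<in> B" "c \<in> B" and "b \<noteq> c" for b c
    using AE_swap[OF that(2) rs[OF that(1,2)]] that(3) by (simp add: swap_def case_prod_unfold)
  have ss: "AE \<omega> in \<Omega>. snd \<omega> b \<noteq> snd \<omega> c" if [measurable]: "b \<in> B" "c \<in> B" and "b \<noteq> c" for b c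
    using AE_swap[OF that(1) rs[OF that(1,2)]] that(3) by (simp add: swap_def case_prod_unfold)
  have nonneg: "AE x in K b. 0 \<le> fst x \<and> 0 \<le> snd x" for b
  proof -
    interpret D: prob_space "D b" by (rule prob_D)
    interpret U: prob_space "U b" by (rule prob_U)
    interpret DU: pair_prob_space "D b" "U b" ..
    have [measurable_cong]: "sets (D b) = sets borel" "sets (U b) = sets borel"
      by (rule sets_D sets_U)+
    show ?thesis
    proof (rule DU.AE_pair_measure)
      show "AE x in D b. AE y in U b. 0 \<le> fst (x, y) \<and> 0 \<le> snd (x, y)"
        using D[of b] U[of b] unfolding nonneg_distribution_def by auto
    qed measurable
  qed
  have r: "AE \<omega> in \<Omega>. 0 \<le> fst (fst \<omega> b) \<and> 0 \<le> snd (fst \<omega> b)" if [measurable]: "b \<in> B" for b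
    unfolding outcomes_def
  proof (rule PP.AE_pair_measure)
    show "AE r in P. AE s in P. 0 \<le> fst (fst (r, s) b) \<and> 0 \<le> snd (fst (r, s) b)"
      using AE_component[OF that nonneg] by eventually_elim simp
  qed measurable
  have s: "AE \<omega> in \<Omega>. 0 \<le> fst (snd \<omega> b) \<and> 0 \<le> snd (snd \<omega> b)" if [measurable]: "b \<in> B" for b
    unfolding outcomes_def
  proof (rule PP.AE_pair_measure)
    show "AE r in P. AE s in P. 0 \<le> fst (snd (r, s) b) \<and> 0 \<le> snd (snd (r, s) b)"
      using AE_component[OF that nonneg] by simp
  qed measurable
  have "AE \<omega> in \<Omega>. \<forall>b\<in>B. \<forall>c\<in>B. (b \<noteq> c \<longrightarrow> fst \<omega> b \<noteq> fst \<omega> c \<and> snd \<omega> b \<noteq> snd \<omega> c) \<and>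
      fst \<omega> b \<noteq> snd \<omega> c"
    using rs rr ss finite_B by (auto simp: AE_ball_countable countable_finite)
  moreover have "AE \<omega> in \<Omega>. \<forall>b\<in>B. (0 \<le> fst (fst \<omega> b) \<and> 0 \<le> snd (fst \<omega> b)) \<and>
      (0 \<le> fst (snd \<omega> b) \<and> 0 \<le> snd (snd \<omega> b))"
    using r s finite_B by (auto simp: AE_ball_countable countable_finite)
  ultimately show ?thesis
    by eventually_elim (auto simp: generic_def draw_le_def)
qed

section \<open>Measurability of the events\<close>

lemma pred_ball_B:
  "(\<And>b. b \<in> B \<Longrightarrow> Measurable.pred M (Q b)) \<Longrightarrow> Measurable.pred M (\<lambda>\<omega>. \<forall>b\<in>B. Q b \<omega>)"
  using finite_B by (rule pred_intros_finite)

lemma pred_generic [measurable]: "Measurable.pred \<Omega> (\<lambda>\<omega>. generic (fst \<omega>) (snd \<omega>))"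
  unfolding generic_def by (intro pred_ball_B pred_intros_logic) measurable

lemma pred_free:
  assumes s: "\<And>c. c \<in> B \<Longrightarrow> (\<lambda>\<omega>. s \<omega> c) \<in> M \<rightarrow>\<^sub>M borel \<Otimes>\<^sub>M borel"
    and x: "x \<in> M \<rightarrow>\<^sub>M borel \<Otimes>\<^sub>M borel" and N: "N \<subseteq> E"
  shows "Measurable.pred M (\<lambda>\<omega>. free (s \<omega>) N b (x \<omega>) = Some i)"
proof -
  \<comment> \<open>Edges start in \<open>B\<close>, so the quantifier over buyers becomes
    finite.\<close>
  have eq: "(\<forall>c. (c, j) \<in> N \<longrightarrow> Q c) \<longleftrightarrow> (\<forall>c\<in>B. (c, j) \<in> N \<longrightarrow> Q c)" for j Q
    using N E_subset by auto
  show ?thesis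
    unfolding free_eq_Some_iff eq
    by (intro pred_intros_logic pred_ball_B pred_intros_finite(3) finite_set pred_draw_le s x) auto
qed

lemma pred_greedy_fixpoint:
  assumes M: "M \<subseteq> E"
  shows "Measurable.pred \<Omega> (\<lambda>\<omega>. greedy_fixpoint (snd \<omega>) M)"
proof -
  have *: "fst e \<in> B" if "e \<in> E" for e
    using E_subset that by auto
  have "Measurable.pred \<Omega> (\<lambda>\<omega>. \<forall>e\<in>E. (e \<in> M) = (free (snd \<omega>) M (fst e) (snd \<omega> (fst e)) = Some (snd e)))"
    by (intro pred_intros_finite(3) finite_E pred_intros_logic pred_free M measurable_sample *) auto
  then show ?thesis
    unfolding greedy_fixpoint_def by (intro pred_intros_logic) auto
qed

lemma pred_wants:
  assumes M: "M \<subseteq> E" and b: "b \<in> B"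
  shows "Measurable.pred \<Omega> (\<lambda>\<omega>. wants (fst \<omega>) (snd \<omega>) M b i)"
proof -
  note [measurable] = pred_free[OF measurable_sample measurable_reward[OF b] M]
    measurable_sample[OF b] measurable_reward[OF b]
  show ?thesis
    unfolding wants_def by measurable
qed

lemma pred_last_wants:
  assumes M: "M \<subseteq> E" and b: "b \<in> B"
  shows "Measurable.pred \<Omega> (\<lambda>\<omega>. last_wants (fst \<omega>) (snd \<omega>) M b i)"
proof -
  note [measurable] = pred_wants[OF M] measurable_reward
  show ?thesis
    unfolding last_wants_def using finite_B b by measurable
qed

abbreviation "N s \<equiv> greedy_matching (edge_order s)"

lemma greedy_fixpoint_N: "inj_on s B \<Longrightarrow> greedy_fixpoint s (N s)"
  by (rule greedy_matching_fixpoint) (use edge_order in auto)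

lemma greedy_fixpoint_iff_eq_N:
  assumes "generic r s"
  shows "greedy_fixpoint s M \<longleftrightarrow> M = N s"
proof
  have N: "greedy_fixpoint s (N s)"
    using greedy_fixpoint_N generic_inj assms by blast
  assume M: "greedy_fixpoint s M"
  have "(b, i) \<in> M \<longleftrightarrow> (b, i) \<in> N s" if b: "b \<in> B" for b i
  proof (rule greedy_fixpoint_cong_above[OF M N _ b])
    \<comment> \<open>A threshold below all nonnegative samples, so that the comparison of the two
      fixed points reaches every buyer.\<close>
    show "draw_lt (-1, 0) (s b)"
      using assms b unfolding generic_def draw_lt_def draw_le_def by fastforce
  qed simp
  then show "M = N s"
    using greedy_fixpoint_buyer_in[OF M] greedy_fixpoint_buyer_in[OF N] by auto
qed (use greedy_fixpoint_N generic_inj assms in blast)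

text \<open>The conjunct \<open>generic r s\<close> removes only a null set and makes
  \<open>N s\<close> the unique fixed point.\<close>

definition event ::
  "(('b \<Rightarrow> draw) \<Rightarrow> ('b \<Rightarrow> draw) \<Rightarrow> ('b \<times> 'i) set \<Rightarrow> bool) \<Rightarrow>
    (('b \<Rightarrow> draw) \<times> ('b \<Rightarrow> draw)) set" where
  "event Q = {(r, s) \<in> space \<Omega>. generic r s \<and> Q r s (N s)}"

text \<open>The order \<open>edge_order s\<close> need not depend measurably on \<open>s\<close>, but for generic draws the greedy
  matching is one of finitely many sets \<open>M\<close> and is determined by a measurable condition.\<close>

lemma sets_event:
  assumes "\<And>M. M \<subseteq> E \<Longrightarrow> Measurable.pred \<Omega> (\<lambda>\<omega>. Q (fst \<omega>) (snd \<omega>) M)"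
  shows "event Q \<in> sets \<Omega>"
proof -
  have "N s \<in> Pow E" if "generic r s" for r s
    using greedy_fixpoint_N generic_inj[OF that] unfolding greedy_fixpoint_def by blast
  then have "event Q = {\<omega> \<in> space \<Omega>. generic (fst \<omega>) (snd \<omega>) \<and>
      (\<exists>M\<in>Pow E. greedy_fixpoint (snd \<omega>) M \<and> Q (fst \<omega>) (snd \<omega>) M)}"
    unfolding event_def using greedy_fixpoint_iff_eq_N by (auto simp: case_prod_unfold)
  moreover have "Measurable.pred \<Omega> (\<lambda>\<omega>. generic (fst \<omega>) (snd \<omega>) \<and>
      (\<exists>M\<in>Pow E. greedy_fixpoint (snd \<omega>) M \<and> Q (fst \<omega>) (snd \<omega>) M))"
    using finite_E
    by (intro pred_intros_logic pred_generic pred_intros_finite(4) pred_greedy_fixpoint assms) auto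
  ultimately show ?thesis
    by simp
qed

definition "Matched b = event (\<lambda>r s M. b \<in> fst ` M)"
definition "Wants b = event (\<lambda>r s M. \<exists>i\<in>set items. wants r s M b i)"
definition "Last b = event (\<lambda>r s M. \<exists>i\<in>set items. last_wants r s M b i)"
definition "Closed b c = event (\<lambda>r s M. \<exists>i\<in>set items. last_wants r s M b i \<and> (c, i) \<in> M)"

lemma sets_Matched [measurable]: "Matched b \<in> sets \<Omega>"
  unfolding Matched_def by (rule sets_event) simp

lemma sets_Wants [measurable]: "b \<in> B \<Longrightarrow> Wants b \<in> sets \<Omega>"
  unfolding Wants_def by (intro sets_event pred_intros_finite(4) pred_wants) auto

lemma sets_Last [measurable]: "b \<in> B \<Longrightarrow> Last b \<in> sets \<Omega>"
  unfolding Last_def by (intro sets_event pred_intros_finite(4) pred_last_wants) auto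

lemma sets_Closed [measurable]: "b \<in> B \<Longrightarrow> Closed b c \<in> sets \<Omega>"
  unfolding Closed_def
  by (intro sets_event pred_intros_finite(4) pred_intros_logic pred_last_wants) auto

lemma wants_item_in: "wants r s M b i \<Longrightarrow> i \<in> set items"
  unfolding wants_def free_eq_Some_iff using E_subset by auto

section \<open>The inequalities in expectation\<close>

abbreviation reward :: "'b \<Rightarrow> ('b \<Rightarrow> draw) \<times> ('b \<Rightarrow> draw) \<Rightarrow> ennreal" where
  "reward b \<omega> \<equiv> ennreal (val (fst \<omega> b))"

abbreviation sample :: "'b \<Rightarrow> ('b \<Rightarrow> draw) \<times> ('b \<Rightarrow> draw) \<Rightarrow> ennreal" where
  "sample b \<omega> \<equiv> ennreal (val (snd \<omega> b))"

text \<open>If the sample is the larger draw, the outcome is bounded by \<open>f\<close> after the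
  exchange, otherwise by \<open>f\<close> itself; both terms have the same integral.\<close>

lemma matched_le_wants:
  assumes b: "b \<in> B"
  shows "(\<integral>\<^sup>+\<omega>. sample b \<omega> * indicator (Matched b) \<omega> \<partial>\<Omega>)
    \<le> 2 * (\<integral>\<^sup>+\<omega>. reward b \<omega> * indicator (Wants b) \<omega> \<partial>\<Omega>)"
proof -
  note [measurable] = b measurable_swap[OF b] sets_Wants[OF b] measurable_reward[OF b]
  define f where "f \<omega> = reward b \<omega> * indicator (Wants b) \<omega>" for \<omega>
  have f [measurable]: "f \<in> borel_measurable \<Omega>"
    unfolding f_def by measurable
  have "sample b \<omega> * indicator (Matched b) \<omega> \<le> f (swap b \<omega>) + f \<omega>" if "\<omega> \<in> space \<Omega>" for \<omega>
  proof (cases "\<omega> \<in> Matched b")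
    case True
    obtain r s where \<omega>: "\<omega> = (r, s)" by fastforce
    obtain i where g: "generic r s" and i: "(b, i) \<in> N s"
      using True unfolding Matched_def event_def \<omega> by auto
    have N: "greedy_fixpoint s (N s)"
      using greedy_fixpoint_N generic_inj[OF g] by blast
    show ?thesis
    proof (cases "draw_lt (r b) (s b)")
      case lt: True
      have g': "generic (r(b := s b)) (s(b := r b))"
        by (rule generic_swap[OF b g])
      then have "greedy_fixpoint (s(b := r b)) (N (s(b := r b)))"
        using greedy_fixpoint_N generic_inj by blast
      from matched_imp_wants_swap[of s "N s" b r, OF N this i lt]
      have "swap b \<omega> \<in> Wants b"
        using g' measurable_space[OF measurable_swap[OF b] that] wants_item_in
        unfolding Wants_def event_def swap_def \<omega> by auto
      then have "f (swap b \<omega>) = sample b \<omega>"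
        by (simp add: f_def swap_def \<omega>)
      then show ?thesis
        by (simp add: indicator_def)
    next
      case False
      then have le: "draw_le (s b) (r b)"
        by auto
      from matched_imp_wants[of s "N s" b i r, OF N i this] have "\<omega> \<in> Wants b"
        using g that wants_item_in unfolding Wants_def event_def \<omega> by auto
      then have "sample b \<omega> \<le> f \<omega>"
        using draw_le_val[OF le] by (simp add: f_def \<omega> ennreal_leI)
      then show ?thesis
        using True by (simp add: add_increasing)
    qed
  qed simp
  then have "(\<integral>\<^sup>+\<omega>. sample b \<omega> * indicator (Matched b) \<omega> \<partial>\<Omega>) \<le> (\<integral>\<^sup>+\<omega>. f (swap b \<omega>) + f \<omega> \<partial>\<Omega>)"
    by (rule nn_integral_mono)
  also have "\<dots> = (\<integral>\<^sup>+\<omega>. f (swap b \<omega>) \<partial>\<Omega>) + (\<integral>\<^sup>+\<omega>. f \<omega> \<partial>\<Omega>)"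
    by (rule nn_integral_add) measurable
  also have "\<dots> = 2 * (\<integral>\<^sup>+\<omega>. f \<omega> \<partial>\<Omega>)"
    unfolding nn_integral_swap[OF b f] by (simp add: mult_2)
  finally show ?thesis
    by (simp add: f_def)
qed

text \<open>If \<open>b\<close> is not last, exchanging the draws of a suitable \<open>c\<close>
  other than \<open>b\<close> leads into \<open>Closed b c\<close> and keeps the reward of
  \<open>b\<close>. The exchanges preserve integrals, and disjointness bounds the sum over
  \<open>c\<close> by \<open>f\<close>.\<close>

lemma wants_le_last:
  assumes b: "b \<in> B"
  shows "(\<integral>\<^sup>+\<omega>. reward b \<omega> * indicator (Wants b) \<omega> \<partial>\<Omega>)
    \<le> 2 * (\<integral>\<^sup>+\<omega>. reward b \<omega> * indicator (Last b) \<omega> \<partial>\<Omega>)"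
proof -
  note [measurable] = sets_Last[OF b] sets_Closed[OF b] measurable_reward[OF b]
  define f where "f \<omega> = reward b \<omega> * indicator (Last b) \<omega>" for \<omega>
  define h where "h c \<omega> = reward b \<omega> * indicator (Closed b c) \<omega>" for c \<omega>
  have f [measurable]: "f \<in> borel_measurable \<Omega>" and h [measurable]: "h c \<in> borel_measurable \<Omega>" for c
    unfolding f_def h_def by measurable
  have "reward b \<omega> * indicator (Wants b) \<omega> \<le> f \<omega> + (\<Sum>c\<in>B - {b}. h c (swap c \<omega>))"
    if sp: "\<omega> \<in> space \<Omega>" for \<omega>
  proof (cases "\<omega> \<in> Wants b")
    case True
    obtain r s where \<omega>: "\<omega> = (r, s)" by fastforce
    obtain i where g: "generic r s" and i: "wants r s (N s) b i"
      using True unfolding Wants_def event_def \<omega> by auto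
    show ?thesis
    proof (cases "last_wants r s (N s) b i")
      case True
      then have "\<omega> \<in> Last b"
        using g sp wants_item_in[OF i] unfolding Last_def event_def \<omega> by auto
      then show ?thesis
        by (simp add: f_def indicator_def)
    next
      case False
      obtain c where c: "c \<in> B - {b}"
        and lw: "last_wants (r(c := s c)) (s(c := r c)) (N (s(c := r c))) b i" "(c, i) \<in> N (s(c := r c))"
        using wants_imp_last_wants_swap[OF greedy_fixpoint_N g i False] by blast
      then have cB: "c \<in> B" by blast
      have "swap c \<omega> \<in> Closed b c"
        using generic_swap[OF cB g] measurable_space[OF measurable_swap[OF cB] sp] lw wants_item_in[OF i]
        unfolding Closed_def event_def swap_def \<omega> by auto
      then have "h c (swap c \<omega>) = reward b \<omega>"
        using c by (auto simp: h_def swap_def \<omega>)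
      moreover have "h c (swap c \<omega>) \<le> (\<Sum>c\<in>B - {b}. h c (swap c \<omega>))"
        using c finite_B by (intro member_le_sum) auto
      ultimately show ?thesis
        by (simp add: indicator_def add_increasing)
    qed
  qed simp
  then have "(\<integral>\<^sup>+\<omega>. reward b \<omega> * indicator (Wants b) \<omega> \<partial>\<Omega>)
      \<le> (\<integral>\<^sup>+\<omega>. f \<omega> + (\<Sum>c\<in>B - {b}. h c (swap c \<omega>)) \<partial>\<Omega>)"
    by (rule nn_integral_mono)
  also have "\<dots> = (\<integral>\<^sup>+\<omega>. f \<omega> \<partial>\<Omega>) + (\<Sum>c\<in>B - {b}. \<integral>\<^sup>+\<omega>. h c (swap c \<omega>) \<partial>\<Omega>)"
  proof -
    have hs: "(\<lambda>\<omega>. h c (swap c \<omega>)) \<in> borel_measurable \<Omega>" if "c \<in> B - {b}" for c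
      using that by (intro measurable_compose[OF measurable_swap h]) auto
    have "(\<Sum>c\<in>B - {b}. \<integral>\<^sup>+\<omega>. h c (swap c \<omega>) \<partial>\<Omega>) =
        (\<integral>\<^sup>+\<omega>. (\<Sum>c\<in>B - {b}. h c (swap c \<omega>)) \<partial>\<Omega>)"
      by (rule nn_integral_sum[symmetric]) (rule hs)
    then show ?thesis
      by (simp only:) (intro nn_integral_add f borel_measurable_sum hs)
  qed
  also have "(\<Sum>c\<in>B - {b}. \<integral>\<^sup>+\<omega>. h c (swap c \<omega>) \<partial>\<Omega>) = (\<Sum>c\<in>B - {b}. \<integral>\<^sup>+\<omega>. h c \<omega> \<partial>\<Omega>)"
    by (intro sum.cong refl nn_integral_swap h) auto
  also have "\<dots> = (\<integral>\<^sup>+\<omega>. (\<Sum>c\<in>B - {b}. h c \<omega>) \<partial>\<Omega>)"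
    by (rule nn_integral_sum[symmetric]) measurable
  also have "\<dots> \<le> (\<integral>\<^sup>+\<omega>. f \<omega> \<partial>\<Omega>)"
  proof (rule nn_integral_mono)
    fix \<omega> :: "('b \<Rightarrow> draw) \<times> ('b \<Rightarrow> draw)"
    obtain r s where \<omega>: "\<omega> = (r, s)" by fastforce
    show "(\<Sum>c\<in>B - {b}. h c \<omega>) \<le> f \<omega>"
    proof (cases "\<exists>c\<in>B - {b}. \<omega> \<in> Closed b c")
      case True
      then obtain c i where c: "c \<in> B - {b}" and sp: "\<omega> \<in> space \<Omega>" and g: "generic r s"
          and i: "i \<in> set items" "last_wants r s (N s) b i" "(c, i) \<in> N s"
        unfolding Closed_def event_def \<omega> by auto
      have N: "greedy_fixpoint s (N s)"
        using greedy_fixpoint_N generic_inj[OF g] by blast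
      \<comment> \<open>The reward of \<open>b\<close> determines the item it wants, and the greedy
        matching determines the holder of that item.\<close>
      have "d = c" if d: "\<omega> \<in> Closed b d" for d
      proof -
        obtain j where j: "last_wants r s (N s) b j" "(d, j) \<in> N s"
          using d unfolding Closed_def event_def \<omega> by auto
        then have "j = i"
          using i(2) unfolding last_wants_def wants_def by simp
        then show ?thesis
          using greedy_fixpoint_unique_buyer[OF N] i(3) j(2) by blast
      qed
      then have "h d \<omega> = 0" if "d \<noteq> c" for d
        using that by (auto simp: h_def indicator_def)
      then have "(\<Sum>c\<in>B - {b}. h c \<omega>) = h c \<omega>"
        using c finite_B by (subst sum.remove[of _ c]) auto
      moreover have "\<omega> \<in> Last b"
        using g i sp unfolding Last_def event_def \<omega> by auto
      ultimately show ?thesis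
        by (simp add: f_def h_def indicator_def)
    qed (simp add: h_def)
  qed
  finally show ?thesis
    unfolding f_def by (simp add: mult_2)
qed

text \<open>Rewards and samples are identically distributed: exchanging all draws at once turns the
  greedy matching on the rewards into the one on the samples.\<close>

lemma opt_le_matched:
  "(\<integral>\<^sup>+(r, s). ennreal (offline_opt B E r) \<partial>\<Omega>)
    \<le> 2 * (\<Sum>b\<in>B. \<integral>\<^sup>+\<omega>. sample b \<omega> * indicator (Matched b) \<omega> \<partial>\<Omega>)"
proof -
  define f where "f \<omega> = 2 * (\<Sum>b\<in>B. sample b \<omega> * indicator (Matched b) \<omega>)" for \<omega>
  have f [measurable]: "f \<in> borel_measurable \<Omega>"
    unfolding f_def by measurable
  have "AE (r, s) in \<Omega>. ennreal (offline_opt B E r) \<le> f (s, r)"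
    using AE_generic AE_space
  proof eventually_elim
    case (elim \<omega>)
    obtain r s where \<omega>: "\<omega> = (r, s)" by fastforce
    have g: "generic s r" and sp: "(s, r) \<in> space \<Omega>"
      using elim generic_flip unfolding \<omega> by (auto simp: outcomes_def space_pair_measure)
    have N: "greedy_fixpoint r (N r)"
      using greedy_fixpoint_N generic_inj[OF g] by blast
    have pos: "0 \<le> val (r b)" if "b \<in> B" for b
      by (rule generic_nonneg[OF generic_flip[OF g] that])
    have m: "(s, r) \<in> Matched b \<longleftrightarrow> b \<in> fst ` N r" for b
      using g sp by (simp add: Matched_def event_def)
    have "fst ` N r \<subseteq> B"
      using greedy_fixpoint_buyer_in[OF N] by auto
    then have "f (s, r) = 2 * (\<Sum>b\<in>fst ` N r. ennreal (val (r b)))"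
      unfolding f_def using finite_B
      by (simp add: indicator_def m if_distrib sum.If_cases Int_absorb1 cong: if_cong)
    also have "\<dots> = ennreal (2 * (\<Sum>b\<in>fst ` N r. val (r b)))"
      using pos \<open>fst ` N r \<subseteq> B\<close> by (subst sum_ennreal) (auto simp: ennreal_mult' subset_eq)
    finally show ?case
      using offline_opt_le_greedy[OF N pos] by (simp add: \<omega> ennreal_leI)
  qed
  then have "(\<integral>\<^sup>+(r, s). ennreal (offline_opt B E r) \<partial>\<Omega>) \<le> (\<integral>\<^sup>+(r, s). f (s, r) \<partial>\<Omega>)"
    by (intro nn_integral_mono_AE) (auto simp: case_prod_unfold)
  also have "\<dots> = (\<integral>\<^sup>+\<omega>. f \<omega> \<partial>distr \<Omega> \<Omega> (\<lambda>(x, y). (y, x)))"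
    using f unfolding outcomes_def by (subst nn_integral_distr) (auto simp: case_prod_unfold)
  also have "\<dots> = (\<integral>\<^sup>+\<omega>. f \<omega> \<partial>\<Omega>)"
    unfolding outcomes_def PP.distr_pair_swap[symmetric] ..
  also have "\<dots> = 2 * (\<Sum>b\<in>B. \<integral>\<^sup>+\<omega>. sample b \<omega> * indicator (Matched b) \<omega> \<partial>\<Omega>)"
    unfolding f_def by (subst nn_integral_cmult) (auto simp: nn_integral_sum)
  finally show ?thesis .
qed

text \<open>The arrival order may depend on all draws in any way; monotonicity of the nonnegative
  integral asks for no measurability of the right-hand side.\<close>

lemma last_le_online:
  assumes arrival: "\<And>r s. set (arrival r s) = B"
  shows "(\<Sum>b\<in>B. \<integral>\<^sup>+\<omega>. reward b \<omega> * indicator (Last b) \<omega> \<partial>\<Omega>) \<le>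
    (\<integral>\<^sup>+(r, s). ennreal (matching_weight r
       (online_matching items E (edge_order s) (arrival r s) r s)) \<partial>\<Omega>)"
proof -
  have "(\<Sum>b\<in>B. \<integral>\<^sup>+\<omega>. reward b \<omega> * indicator (Last b) \<omega> \<partial>\<Omega>) =
      (\<integral>\<^sup>+\<omega>. (\<Sum>b\<in>B. reward b \<omega> * indicator (Last b) \<omega>) \<partial>\<Omega>)"
    by (rule nn_integral_sum[symmetric]) measurable
  also have "\<dots> \<le> (\<integral>\<^sup>+(r, s). ennreal (matching_weight r
       (online_matching items E (edge_order s) (arrival r s) r s)) \<partial>\<Omega>)"
  proof (rule nn_integral_mono_AE, use AE_generic AE_space in eventually_elim)
    case (elim \<omega>)
    obtain r s where \<omega>: "\<omega> = (r, s)" by fastforce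
    have g: "generic r s" and sp: "(r, s) \<in> space \<Omega>"
      using elim unfolding \<omega> by auto
    have N: "greedy_fixpoint s (N s)"
      using greedy_fixpoint_N generic_inj[OF g] by blast
    have pos: "0 \<le> val (r b)" if "b \<in> B" for b
      by (rule generic_nonneg[OF g that])
    have m: "(r, s) \<in> Last b \<longleftrightarrow> (\<exists>i. last_wants r s (N s) b i)" for b
      using g sp wants_item_in unfolding Last_def event_def last_wants_def by auto
    have "(\<Sum>b\<in>B. reward b \<omega> * indicator (Last b) \<omega>) =
        (\<Sum>b | b \<in> B \<and> (\<exists>i. last_wants r s (N s) b i). ennreal (val (r b)))"
      using finite_B unfolding \<omega>
      by (simp add: indicator_def m if_distrib sum.If_cases Int_def cong: if_cong)
    also have "\<dots> = ennreal (\<Sum>b | b \<in> B \<and> (\<exists>i. last_wants r s (N s) b i). val (r b))"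
      using pos by (intro sum_ennreal) auto
    finally show ?case
      using last_wants_le_online[OF N g arrival] by (simp add: \<omega> ennreal_leI)
  qed
  finally show ?thesis .
qed

lemma opt_le_online:
  assumes "\<And>r s. set (arrival r s) = B"
  shows "(\<integral>\<^sup>+(r, s). ennreal (offline_opt B E r) \<partial>\<Omega>) \<le>
    8 * (\<integral>\<^sup>+(r, s). ennreal (matching_weight r
       (online_matching items E (edge_order s) (arrival r s) r s)) \<partial>\<Omega>)"
proof -
  define a w l
    where "a b = (\<integral>\<^sup>+\<omega>. sample b \<omega> * indicator (Matched b) \<omega> \<partial>\<Omega>)"
      and "w b = (\<integral>\<^sup>+\<omega>. reward b \<omega> * indicator (Wants b) \<omega> \<partial>\<Omega>)"
      and "l b = (\<integral>\<^sup>+\<omega>. reward b \<omega> * indicator (Last b) \<omega> \<partial>\<Omega>)" for b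
  have "a b \<le> 4 * l b" if "b \<in> B" for b
  proof -
    have "a b \<le> 2 * w b"
      unfolding a_def w_def by (rule matched_le_wants[OF that])
    also have "\<dots> \<le> 2 * (2 * l b)"
      unfolding w_def l_def by (intro mult_left_mono wants_le_last[OF that]) simp
    finally show ?thesis
      by (simp add: mult.assoc[symmetric])
  qed
  then have "2 * (\<Sum>b\<in>B. a b) \<le> 2 * (\<Sum>b\<in>B. 4 * l b)"
    by (intro mult_left_mono sum_mono) auto
  also have "\<dots> = 8 * (\<Sum>b\<in>B. l b)"
    by (simp add: sum_distrib_left[symmetric] mult.assoc[symmetric])
  finally have "2 * (\<Sum>b\<in>B. a b) \<le> 8 * (\<Sum>b\<in>B. l b)" .
  moreover have "8 * (\<Sum>b\<in>B. l b) \<le> 8 * (\<integral>\<^sup>+(r, s). ennreal (matching_weight r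
       (online_matching items E (edge_order s) (arrival r s) r s)) \<partial>\<Omega>)"
    unfolding l_def by (intro mult_left_mono last_le_online assms) simp
  ultimately show ?thesis
    using opt_le_matched unfolding a_def by (meson order_trans)
qed

end

theorem theorem4:
  fixes B :: "'b set" and items :: "'i list" and E :: "('b \<times> 'i) set"
    and D U :: "'b \<Rightarrow> real measure"
    and edge_order :: "('b \<Rightarrow> draw) \<Rightarrow> ('b \<times> 'i) list"
    and arrival :: "('b \<Rightarrow> draw) \<Rightarrow> ('b \<Rightarrow> draw) \<Rightarrow> 'b list"
  assumes "finite B"
    and "distinct items"
    and "E \<subseteq> B \<times> set items"
    and "\<And>b. b \<in> B \<Longrightarrow> nonneg_distribution (D b)"
    and "\<And>b. b \<in> B \<Longrightarrow> nonneg_distribution (U b)"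
    and "\<And>b. b \<in> B \<Longrightarrow> atomless (D b) \<or> atomless (U b)"
    and "\<And>s. greedy_order items E s (edge_order s)"
    and "\<And>r s. distinct (arrival r s) \<and> set (arrival r s) = B"
  shows "8 * (\<integral>\<^sup>+(r, s). ennreal (matching_weight r
               (online_matching items E (edge_order s) (arrival r s) r s)) \<partial>outcomes B D U)
         \<ge> (\<integral>\<^sup>+(r, s). ennreal (offline_opt B E r) \<partial>outcomes B D U)"
proof -
  \<comment> \<open>The product over \<open>B\<close> does not see indices outside \<open>B\<close>;
    a point mass at 0 there extends the hypotheses to the whole type.\<close>
  define D' where "D' b = (if b \<in> B then D b else return borel 0)" for b
  define U' where "U' b = (if b \<in> B then U b else return borel 0)" for b
  have return: "nonneg_distribution (return borel 0)"
    by (simp add: nonneg_distribution_def prob_space_return AE_return)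
  interpret sampled_graph B items E D' U' edge_order
  proof
    show "nonneg_distribution (D' b)" "nonneg_distribution (U' b)" for b
      using assms(4,5)[of b] return by (simp_all add: D'_def U'_def)
    show "atomless (D' b) \<or> atomless (U' b)" if "b \<in> B" for b
      using assms(6)[OF that] that by (simp add: D'_def U'_def)
  qed (fact assms)+
  have "outcomes B D U = outcomes B D' U'"
    unfolding outcomes_def draws_def by (simp add: D'_def U'_def cong: PiM_cong)
  moreover have "set (arrival r s) = B" for r s
    using assms(8) by blast
  ultimately show ?thesis
    using opt_le_online[of arrival] by simp
qed

end
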